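(* There is an absolute constant $C$ such that the following holds. Let $f\colon \{-1,1\}^n \to [-1,1]$ be a symmetric function of degree $d\ge1$, where $d < \sqrt{n}$. Then \[ \mathrm{Inf}[f] \leq \frac{n}{n-d^2} \left(d + C\,\frac{d\log (dn)}{n} \right). \]
   Context: The degree of $f\colon\{-1,1\}^n\to\mathbb{R}$ is the degree of its unique multilinear polynomial representation. $f$ is symmetric if $f(\mathbf{x})$ depends only on $x_1+\cdots+x_n$. With $x\oplus e_i$ the point $x$ with $i$th coordinate flipped, $\mathrm{Inf}[f]=\sum_{i=1}^n\mathbb{E}_x\left|\frac{f(x)-f(x\oplus e_i)}{2}\right|$, $x$ uniform on $\{-1,1\}^n$. *)

theory Defs
  imports "HOL-Analysis.Analysis"
begin

text \<open>The cube {-1,1}^n, with coordinates indexed by 0, ..., n - 1. Points are extensional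
  functions, so that distinct elements are distinct points and the cube is finite.\<close>

definition cube :: "nat \<Rightarrow> (nat \<Rightarrow> real) set" where
  "cube n = {..<n} \<rightarrow>\<^sub>E {-1, 1}"

text \<open>A multilinear polynomial in n variables is given by its coefficients: c S is the
  coefficient of the monomial that is the product of the x i over i in S.\<close>

definition multilinear_eval :: "nat \<Rightarrow> (nat set \<Rightarrow> real) \<Rightarrow> (nat \<Rightarrow> real) \<Rightarrow> real" where
  "multilinear_eval n c x = (\<Sum>S\<in>Pow {..<n}. c S * (\<Prod>i\<in>S. x i))"

text \<open>The second conjunct fixes the irrelevant values of c, so that the representation is
  unique as a function on all sets.\<close>

definition represents :: "nat \<Rightarrow> (nat set \<Rightarrow> real) \<Rightarrow> ((nat \<Rightarrow> real) \<Rightarrow> real) \<Rightarrow> bool" where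
  "represents n c f \<longleftrightarrow>
     (\<forall>x\<in>cube n. f x = multilinear_eval n c x) \<and> (\<forall>S. \<not> S \<subseteq> {..<n} \<longrightarrow> c S = 0)"

definition multilinear_coeffs :: "nat \<Rightarrow> ((nat \<Rightarrow> real) \<Rightarrow> real) \<Rightarrow> nat set \<Rightarrow> real" where
  "multilinear_coeffs n f = (THE c. represents n c f)"

text \<open>Inserting 0 gives the zero function degree 0.\<close>

definition cube_degree :: "nat \<Rightarrow> ((nat \<Rightarrow> real) \<Rightarrow> real) \<Rightarrow> nat" where
  "cube_degree n f = Max (insert 0 (card ` {S. S \<subseteq> {..<n} \<and> multilinear_coeffs n f S \<noteq> 0}))"

definition symmetric_on_cube :: "nat \<Rightarrow> ((nat \<Rightarrow> real) \<Rightarrow> real) \<Rightarrow> bool" where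
  "symmetric_on_cube n f \<longleftrightarrow>
     (\<forall>x\<in>cube n. \<forall>y\<in>cube n. (\<Sum>i<n. x i) = (\<Sum>i<n. y i) \<longrightarrow> f x = f y)"

definition flip :: "(nat \<Rightarrow> real) \<Rightarrow> nat \<Rightarrow> (nat \<Rightarrow> real)" where
  "flip x i = x(i := - x i)"

definition cube_expectation :: "nat \<Rightarrow> ((nat \<Rightarrow> real) \<Rightarrow> real) \<Rightarrow> real" where
  "cube_expectation n g = (\<Sum>x\<in>cube n. g x) / real (card (cube n))"

definition Influence :: "nat \<Rightarrow> ((nat \<Rightarrow> real) \<Rightarrow> real) \<Rightarrow> real" where
  "Influence n f = (\<Sum>i<n. cube_expectation n (\<lambda>x. \<bar>(f x - f (flip x i)) / 2\<bar>))"

lemma finite_cube: "finite (cube n)"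
  by (simp add: cube_def finite_PiE)

lemma card_cube: "card (cube n) = 2 ^ n"
  by (simp add: cube_def card_PiE card_insert_if numeral_2_eq_2)

lemma flip_in_cube: "x \<in> cube n \<Longrightarrow> i < n \<Longrightarrow> flip x i \<in> cube n"
  unfolding cube_def flip_def by (auto simp: PiE_iff extensional_def)

lemma sum_monomials_cube:
  assumes x: "x \<in> cube n" and y: "y \<in> cube n"
  shows "(\<Sum>S\<in>Pow {..<n}. (\<Prod>i\<in>S. x i) * (\<Prod>i\<in>S. y i)) = (if x = y then 2 ^ n else 0)"
proof -
  have "(\<Prod>i<n. x i * y i + 1) = (\<Sum>S\<in>Pow {..<n}. (\<Prod>i\<in>S. x i * y i) * (\<Prod>i\<in>{..<n}-S. 1))"
    by (rule prod_add) simp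
  then have eq: "(\<Sum>S\<in>Pow {..<n}. (\<Prod>i\<in>S. x i) * (\<Prod>i\<in>S. y i)) = (\<Prod>i<n. x i * y i + 1)"
    by (simp add: prod.distrib)
  show ?thesis
  proof (cases "x = y")
    case True
    have "(\<Prod>i<n. x i * y i + 1) = (\<Prod>i<n. 2)"
      by (rule prod.cong) (use x True in \<open>force simp: cube_def PiE_iff\<close>)+
    then show ?thesis using eq True by simp
  next
    case False
    then obtain i where i: "i < n" "x i \<noteq> y i"
      using x y PiE_ext[of x "{..<n}" "\<lambda>_. {-1,1}" y] by (auto simp: cube_def)
    moreover have "x i \<in> {-1,1}" "y i \<in> {-1,1}" using x y i by (auto simp: cube_def PiE_iff)
    ultimately have "x i * y i + 1 = 0" by auto
    with i have "(\<Prod>i<n. x i * y i + 1) = 0" by auto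
    then show ?thesis using eq False by simp
  qed
qed

lemma sum_cube_monomials:
  assumes S: "S \<subseteq> {..<n}" and T: "T \<subseteq> {..<n}"
  shows "(\<Sum>x\<in>cube n. (\<Prod>i\<in>S. x i) * (\<Prod>i\<in>T. x i)) = (if S = T then 2 ^ n else 0)"
proof -
  define g :: "nat \<Rightarrow> real \<Rightarrow> real"
    where "g i v = (if i \<in> S then v else 1) * (if i \<in> T then v else 1)" for i v
  have restr: "(\<Prod>i<n. if i \<in> A then x i else 1) = (\<Prod>i\<in>A. x i)"
    if "A \<subseteq> {..<n}" for A and x :: "nat \<Rightarrow> real"
    using that by (simp add: prod.If_cases Int_absorb1)
  have "(\<Sum>x\<in>cube n. (\<Prod>i\<in>S. x i) * (\<Prod>i\<in>T. x i)) = (\<Sum>x\<in>cube n. \<Prod>i<n. g i (x i))"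
    unfolding g_def using S T by (simp add: prod.distrib restr)
  also have "\<dots> = (\<Prod>i<n. \<Sum>v\<in>{-1,1}. g i v)"
    unfolding cube_def by (rule prod_sum_PiE[symmetric]) auto
  also have "\<dots> = (if S = T then 2 ^ n else 0)"
  proof (cases "S = T")
    case True
    have "(\<Prod>i<n. \<Sum>v\<in>{-1,1}. g i v) = (\<Prod>i<n. 2)"
      by (rule prod.cong) (auto simp: g_def True)
    then show ?thesis using True by simp
  next
    case False
    then obtain i where i: "i < n" "(i \<in> S) \<noteq> (i \<in> T)" using S T by blast
    then have "(\<Sum>v\<in>{-1,1}. g i v) = 0" by (auto simp: g_def)
    then have "(\<Prod>i<n. \<Sum>v\<in>{-1,1}. g i v) = 0" using i(1) by (intro prod_zero) auto
    then show ?thesis using False by simp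
  qed
  finally show ?thesis .
qed

lemma represents_coeff:
  assumes "represents n c f" and S: "S \<subseteq> {..<n}"
  shows "c S = (\<Sum>x\<in>cube n. f x * (\<Prod>i\<in>S. x i)) / 2 ^ n"
proof -
  have "(\<Sum>x\<in>cube n. f x * (\<Prod>i\<in>S. x i)) =
      (\<Sum>x\<in>cube n. \<Sum>T\<in>Pow {..<n}. c T * ((\<Prod>i\<in>S. x i) * (\<Prod>i\<in>T. x i)))"
    using assms by (intro sum.cong)
      (auto simp: represents_def multilinear_eval_def sum_distrib_left mult_ac)
  also have "\<dots> = (\<Sum>T\<in>Pow {..<n}. c T * (\<Sum>x\<in>cube n. (\<Prod>i\<in>S. x i) * (\<Prod>i\<in>T. x i)))"
    by (subst sum.swap) (simp add: sum_distrib_left)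
  also have "\<dots> = (\<Sum>T\<in>Pow {..<n}. if T = S then c T * 2 ^ n else 0)"
    using S by (intro sum.cong) (auto simp: sum_cube_monomials)
  also have "\<dots> = c S * 2 ^ n"
    using S by (simp add: sum.delta)
  finally show ?thesis by simp
qed

lemma represents_ex1: "\<exists>!c. represents n c f"
proof (rule ex_ex1I)
  define c where
    "c S = (if S \<subseteq> {..<n} then (\<Sum>y\<in>cube n. f y * (\<Prod>i\<in>S. y i)) / 2 ^ n else 0)" for S
  have "multilinear_eval n c x = f x" if x: "x \<in> cube n" for x
  proof -
    have "multilinear_eval n c x =
        (\<Sum>S\<in>Pow {..<n}. \<Sum>y\<in>cube n. f y / 2 ^ n * ((\<Prod>i\<in>S. x i) * (\<Prod>i\<in>S. y i)))"
      unfolding multilinear_eval_def c_def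
      by (intro sum.cong) (auto simp: sum_distrib_left sum_distrib_right sum_divide_distrib mult_ac)
    also have "\<dots> =
        (\<Sum>y\<in>cube n. f y / 2 ^ n * (\<Sum>S\<in>Pow {..<n}. (\<Prod>i\<in>S. x i) * (\<Prod>i\<in>S. y i)))"
      by (subst sum.swap) (simp add: sum_distrib_left)
    also have "\<dots> = (\<Sum>y\<in>cube n. if y = x then f y else 0)"
      using x by (intro sum.cong) (auto simp: sum_monomials_cube)
    also have "\<dots> = f x" using x by (simp add: finite_cube)
    finally show ?thesis .
  qed
  then have "represents n c f" by (simp add: represents_def c_def)
  then show "\<exists>c. represents n c f" by blast
next
  fix c c' assume *: "represents n c f" "represents n c' f"
  show "c = c'"
  proof
    fix S show "c S = c' S"
      using * represents_coeff[OF *(1), of S] represents_coeff[OF *(2), of S]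
      by (cases "S \<subseteq> {..<n}") (auto simp: represents_def)
  qed
qed

lemma represents_multilinear_coeffs: "represents n (multilinear_coeffs n f) f"
  unfolding multilinear_coeffs_def by (rule theI'[OF represents_ex1])

end

theory Submission
  imports Defs "HOL-Computational_Algebra.Polynomial"
begin

text \<open>A symmetric f of degree d is p ((x 1 + ... + x n) / n) for a univariate polynomial p of degree
  at most d. Comparing p (cos t) with sin (d t + \<phi>) and counting zeros shows that
  arcsin (p (cos t) / A) is d-Lipschitz whenever |p| < A on [-1,1]. Near a maximum point of |p| this
  forces p (cos t) to stay above a cosine of frequency d, and as |p| \<le> 1 at the n + 1 equispaced
  points, |p| \<le> M = n / (n - d^2) on [-1,1]. It also gives Bernstein's inequality
  |p'(y)| \<le> d M / sqrt (1 - y^2) in integrated form, so that flipping a coordinate of x changes f / 2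
  by at most (d M / n) (1 + O(y^2 + 1 / n^2)) when the mean y of x satisfies |y| \<le> 1/2. The second
  moment of y contributes the error O(d M / n), and by the fourth moment |y| > 1/2 has probability
  O(1 / n^2), which contributes O(1 / n).\<close>

section \<open>Bernstein-type inequalities for algebraic polynomials\<close>

lemma cis_inj_on_period:
  assumes "\<And>s t. s \<in> Z \<Longrightarrow> t \<in> Z \<Longrightarrow> \<bar>s - t\<bar> < 2 * pi"
  shows "inj_on cis Z"
proof (rule inj_onI)
  fix s t assume st: "s \<in> Z" "t \<in> Z" "cis s = cis t"
  then have "sin s = sin t \<and> cos s = cos t" by (simp add: complex_eq_iff)
  then obtain m :: int where m: "s = t + 2 * pi * m"
    using sin_cos_eq_iff by metis
  have "\<bar>s - t\<bar> < 2 * pi" by (rule assms) (use st in auto)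
  then have "2 * pi * \<bar>real_of_int m\<bar> < 2 * pi * 1" using m by (simp add: abs_mult)
  then have "\<bar>real_of_int m\<bar> < 1" by (simp only: mult_less_cancel_left) auto
  then have "m = 0" by linarith
  then show "s = t" using m by simp
qed

text \<open>Multiplied by \<open>z ^ d\<close> with \<open>z = cis t\<close>, the difference of the
  two sides is a polynomial in \<open>z\<close> of degree at most \<open>2 * d\<close>. The points
  of \<open>Z\<close> are less than a period apart and so give distinct zeros on the unit circle;
  more than \<open>2 * d\<close> of them make it vanish identically.\<close>

lemma trig_interpolation_unique:
  fixes p :: "real poly"
  assumes deg: "degree p \<le> d" and fin: "finite Z" and cardZ: "card Z > 2 * d"
    and diam: "\<And>s t. s \<in> Z \<Longrightarrow> t \<in> Z \<Longrightarrow> \<bar>s - t\<bar> < 2 * pi"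
    and zero: "\<And>t. t \<in> Z \<Longrightarrow> poly p (cos t) = sin (real d * t + \<phi>)"
  shows "poly p (cos t) = sin (real d * t + \<phi>)"
proof -
  \<comment> \<open>On the unit circle \<open>cos t = (z + 1 / z) / 2\<close>, which turns
    \<open>z ^ d * cos t ^ k\<close> into \<open>z ^ (d - k) * (1 + z ^ 2) ^ k / 2 ^ k\<close>. The
    subtracted term is \<open>z ^ d * sin (d * t + \<phi>)\<close> by Euler's formula.\<close>
  define Q :: "complex poly" where
    "Q = (\<Sum>k\<le>d. smult (of_real (coeff p k / 2 ^ k)) (monom 1 (d - k) * [:1, 0, 1:] ^ k))
       - smult (1 / (2 * \<i>)) (smult (cis \<phi>) (monom 1 (2 * d)) - [:cis (- \<phi>):])"
  have Q: "poly Q (cis t) = cis t ^ d * of_real (poly p (cos t) - sin (real d * t + \<phi>))" for t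
  proof -
    let ?z = "cis t"
    have z2: "1 + ?z * ?z = of_real (2 * cos t) * ?z"
      by (simp add: complex_eq_iff power2_eq_square[symmetric] cos_double sin_double cis_mult
          cos_squared_eq) (simp add: cos_add sin_add power2_eq_square algebra_simps sin_cos_squared_add3)
    have summand: "of_real (coeff p k / 2 ^ k) * (?z ^ (d - k) * (1 + ?z * ?z) ^ k)
        = ?z ^ d * of_real (coeff p k * cos t ^ k)" if "k \<le> d" for k
    proof -
      have "?z ^ (d - k) * (1 + ?z * ?z) ^ k = ?z ^ (d - k) * ?z ^ k * of_real ((2 * cos t) ^ k)"
        by (simp only: z2 power_mult_distrib) (simp add: power_mult_distrib)
      also have "?z ^ (d - k) * ?z ^ k = ?z ^ d" using that by (simp flip: power_add)
      finally show ?thesis by (simp add: power_mult_distrib)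
    qed
    have pp: "poly p (cos t) = (\<Sum>k\<le>d. coeff p k * cos t ^ k)"
      unfolding poly_altdef using deg by (intro sum.mono_neutral_left) (auto simp: coeff_eq_0)
    have "poly Q ?z = (\<Sum>k\<le>d. of_real (coeff p k / 2 ^ k) * (?z ^ (d - k) * (1 + ?z * ?z) ^ k))
       - (cis \<phi> * ?z ^ (2 * d) - cis (- \<phi>)) / (2 * \<i>)"
      unfolding Q_def by (simp add: poly_sum poly_monom)
    also have "(\<Sum>k\<le>d. of_real (coeff p k / 2 ^ k) * (?z ^ (d - k) * (1 + ?z * ?z) ^ k))
        = ?z ^ d * of_real (poly p (cos t))"
      unfolding pp using summand by (simp add: sum_distrib_left)
    also have "(cis \<phi> * ?z ^ (2 * d) - cis (- \<phi>)) / (2 * \<i>) = ?z ^ d * of_real (sin (real d * t + \<phi>))"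
    proof -
      have "cis \<phi> * ?z ^ (2 * d) = ?z ^ d * cis (real d * t + \<phi>)"
        by (simp add: Complex.DeMoivre cis_mult algebra_simps)
      moreover have "cis (- \<phi>) = ?z ^ d * cis (- (real d * t + \<phi>))"
        by (simp add: Complex.DeMoivre cis_mult algebra_simps)
      moreover have "cis u - cis (- u) = 2 * \<i> * of_real (sin u)" for u
        by (simp add: complex_eq_iff)
      ultimately have "cis \<phi> * ?z ^ (2 * d) - cis (- \<phi>)
          = ?z ^ d * (2 * \<i> * of_real (sin (real d * t + \<phi>)))"
        by (metis right_diff_distrib)
      then show ?thesis by (simp add: field_simps)
    qed
    finally show ?thesis by (simp add: algebra_simps)
  qed
  have "degree Q \<le> 2 * d"
    unfolding Q_def
  proof (intro degree_diff_le degree_sum_le)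
    fix k assume "k \<in> {..d}"
    then have k: "k \<le> d" by simp
    have "degree ([:1, 0, 1:] ^ k :: complex poly) \<le> 2 * k"
      using degree_power_le[of "[:1, 0, 1:] :: complex poly" k] by simp
    moreover have "degree (monom 1 (d - k) :: complex poly) \<le> d - k" by (rule degree_monom_le)
    ultimately have "degree (monom 1 (d - k) * [:1, 0, 1:] ^ k :: complex poly) \<le> (d - k) + 2 * k"
      using degree_mult_le[of "monom 1 (d - k) :: complex poly" "[:1, 0, 1:] ^ k"] by linarith
    then show "degree (smult (of_real (coeff p k / 2 ^ k)) (monom 1 (d - k) * [:1, 0, 1:] ^ k) :: complex poly) \<le> 2 * d"
      using k by (intro order.trans[OF degree_smult_le]) linarith
  next
    have "degree (smult (cis \<phi>) (monom 1 (2 * d)) - [:cis (- \<phi>):]) \<le> 2 * d"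
      by (intro degree_diff_le order.trans[OF degree_smult_le] degree_monom_le) auto
    then show "degree (smult (1 / (2 * \<i>)) (smult (cis \<phi>) (monom 1 (2 * d)) - [:cis (- \<phi>):])) \<le> 2 * d"
      by (intro order.trans[OF degree_smult_le])
  qed simp
  moreover have "card Z \<le> degree Q" if "Q \<noteq> 0"
  proof -
    have "card Z = card (cis ` Z)"
      using cis_inj_on_period[OF diam] by (simp add: card_image)
    also have "\<dots> \<le> card {z. poly Q z = 0}"
      using zero by (intro card_mono poly_roots_finite that) (auto simp: Q)
    also have "\<dots> \<le> degree Q" by (rule card_poly_roots_bound[OF that])
    finally show ?thesis .
  qed
  ultimately have "Q = 0" using cardZ by fastforce
  then have "cis t ^ d * of_real (poly p (cos t) - sin (real d * t + \<phi>)) = 0" using Q[of t] by simp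
  then show ?thesis by (simp del: of_real_diff)
qed

text \<open>The intermediate value theorem gives a zero between neighbouring nodes. It is never a
  node, since \<open>S\<close> does not vanish there, so the \<open>N\<close> zeros are
  distinct.\<close>

lemma alternating_zeros:
  fixes S :: "real \<Rightarrow> real"
  assumes cont: "continuous_on UNIV S" and mono: "\<And>i. i < N \<Longrightarrow> t i < t (Suc i)"
    and sgn: "\<And>i. i \<le> N \<Longrightarrow> (-1) ^ i * S (t i) > 0"
  shows "\<exists>Z. finite Z \<and> card Z = N \<and> Z \<subseteq> {t 0<..<t N} \<and> (\<forall>z\<in>Z. S z = 0)"
proof -
  have "\<exists>z. t i < z \<and> z < t (Suc i) \<and> S z = 0" if "i < N" for i
  proof -
    have a: "(-1) ^ i * S (t i) > 0" "(-1) ^ i * S (t (Suc i)) < 0"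
      using sgn[of i] sgn[of "Suc i"] that by auto
    have "\<exists>x\<ge>t i. x \<le> t (Suc i) \<and> (-1) ^ i * S x = 0"
      by (rule IVT2') (use a mono[OF that] in
          \<open>auto intro!: continuous_intros continuous_on_subset[OF cont]\<close>)
    then obtain x where "t i \<le> x" "x \<le> t (Suc i)" "S x = 0" by auto
    moreover have "S (t i) \<noteq> 0" "S (t (Suc i)) \<noteq> 0" using a by auto
    ultimately show ?thesis by (metis order_le_less)
  qed
  then obtain z where z: "\<And>i. i < N \<Longrightarrow> t i < z i \<and> z i < t (Suc i) \<and> S (z i) = 0" by metis
  have tm: "t i \<le> t j" if "i \<le> j" "j \<le> N" for i j
    using that by (induction rule: dec_induct) (use mono in \<open>auto intro: order.trans less_imp_le simp: Suc_le_eq\<close>)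
  have less: "z i < z j" if "i < j" "j < N" for i j
    using z[of i] z[of j] tm[of "Suc i" j] that by auto
  have "inj_on z {..<N}"
    by (rule linorder_inj_onI) (use less in force)+
  moreover have "z i \<in> {t 0<..<t N}" if "i < N" for i
    using z[OF that] tm[of 0 i] tm[of "Suc i" N] that by auto
  ultimately show ?thesis
    using z by (intro exI[of _ "z ` {..<N}"]) (auto simp: card_image)
qed

text \<open>If the increase from s to t were too large, one could choose the phase so that the difference
  S of the two functions changes sign three times, instead of once, on a rising branch of
  sin (d x + \<phi>); together with one sign change on each other branch this gives 2 d + 2 zeros in a
  period, two more than a trigonometric polynomial of degree d can have.\<close>

lemma arcsin_poly_cos_increase:
  fixes p :: "real poly"
  assumes deg: "degree p \<le> d" and d: "d \<ge> 1"
    and bound: "\<And>x. \<bar>x\<bar> \<le> 1 \<Longrightarrow> \<bar>poly p x\<bar> < 1" and le: "s \<le> t"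
  shows "arcsin (poly p (cos t)) - arcsin (poly p (cos s)) \<le> real d * (t - s)"
proof (rule ccontr)
  let ?T = "\<lambda>t. poly p (cos t)"
  define u where "u = arcsin (?T s)"
  define v where "v = arcsin (?T t)"
  have T: "-1 < ?T t" "?T t < 1" for t using bound[of "cos t"] by auto
  assume "\<not> arcsin (?T t) - arcsin (?T s) \<le> real d * (t - s)"
  then have gt: "v - u > real d * (t - s)" by (simp add: u_def v_def)
  with le have "s < t" by (cases "s = t") (auto simp: u_def v_def)
  have uv: "-pi/2 < u" "v < pi/2" "sin u = ?T s" "sin v = ?T t"
    unfolding u_def v_def using T arcsin_lt_bounded[OF T] by (auto simp: less_imp_le)
  \<comment> \<open>Room for the phase: the sine will have argument \<open>w > u\<close> at
    \<open>s\<close> and \<open>w + d * (t - s) < v\<close> at \<open>t\<close>, so that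
    \<open>S\<close> is negative at \<open>s\<close> and positive at \<open>t\<close>.\<close>
  obtain w where w: "u < w" "w < v - real d * (t - s)" using gt dense[of u "v - real d * (t - s)"] by auto
  define \<phi> where "\<phi> = w - real d * s"
  \<comment> \<open>The start of the rising branch that contains \<open>s\<close> and
    \<open>t\<close>; the sine is -1 there.\<close>
  define \<alpha> where "\<alpha> = (- pi/2 - \<phi>) / d"
  define S where "S x = ?T x - sin (real d * x + \<phi>)" for x
  \<comment> \<open>Beyond \<open>t\<close> the nodes are extrema of the sine, beginning with the
    end \<open>\<alpha> + pi / d\<close> of the branch; hence the shift of the index by 2. The last
    node, with index \<open>2 * d + 2\<close>, is \<open>\<alpha> + 2 * pi\<close>.\<close>
  define \<tau> where "\<tau> i = (if i = 0 then \<alpha> else if i = 1 then s else if i = 2 then t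
     else \<alpha> + (real i - 2) * pi / d)" for i :: nat
  have d0: "real d > 0" using d by simp
  have dt: "real d * (t - s) > 0" using d0 \<open>s < t\<close> by simp
  have da: "real d * \<alpha> + \<phi> = - pi/2" using d0 by (simp add: \<alpha>_def)
  have ds: "real d * s + \<phi> = w" by (simp add: \<phi>_def)
  have dT: "real d * t + \<phi> = w + real d * (t - s)" by (simp add: \<phi>_def algebra_simps)
  have ord: "\<alpha> < s" "t < \<alpha> + pi / d"
  proof -
    have "real d * \<alpha> < real d * s" using da ds uv w by linarith
    then show "\<alpha> < s" using d0 by simp
    have "real d * t < real d * \<alpha> + pi" using da dT uv w by linarith
    also have "\<dots> = real d * (\<alpha> + pi / d)" using d0 by (simp add: field_simps)
    finally show "t < \<alpha> + pi / d" using d0 by simp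
  qed
  have "\<exists>Z. finite Z \<and> card Z = 2 * d + 2 \<and> Z \<subseteq> {\<tau> 0<..<\<tau> (2 * d + 2)} \<and> (\<forall>z\<in>Z. S z = 0)"
  proof (rule alternating_zeros)
    show "continuous_on UNIV S" unfolding S_def by (intro continuous_intros)
  next
    fix i :: nat
    have "\<alpha> + (real i - 2) * pi / d < \<alpha> + (real (Suc i) - 2) * pi / d"
      using d0 by (simp add: divide_strict_right_mono)
    then show "\<tau> i < \<tau> (Suc i)"
      using ord \<open>s < t\<close> by (auto simp: \<tau>_def)
  next
    fix i :: nat
    consider "i = 0" | "i = 1" | "i = 2" | "i \<ge> 3" by linarith
    then show "(-1) ^ i * S (\<tau> i) > 0"
    proof cases
      case 1
      then show ?thesis using T[of \<alpha>] by (simp add: \<tau>_def S_def da)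
    next
      case 2
      have "sin u < sin w" by (rule sin_monotone_2pi) (use uv w dt in auto)
      then show ?thesis using 2 uv by (simp add: \<tau>_def S_def ds)
    next
      case 3
      have "sin (w + real d * (t - s)) < sin v"
        by (rule sin_monotone_2pi) (use uv w dt in auto)
      then show ?thesis using 3 uv by (simp add: \<tau>_def S_def dT)
    next
      case 4
      then obtain k where k: "i = k + 2" using le_Suc_ex[of 2 i] by (auto simp: add.commute)
      have "real d * \<tau> i + \<phi> = (real d * \<alpha> + \<phi>) + real k * pi"
        using 4 d0 k by (simp add: \<tau>_def field_simps)
      then have "sin (real d * \<tau> i + \<phi>) = - ((-1) ^ k)"
        unfolding da by (simp add: sin_diff)
      then have "(-1) ^ i * S (\<tau> i) = (-1) ^ k * ?T (\<tau> i) + 1"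
        unfolding S_def k by (simp add: algebra_simps flip: power_mult_distrib)
      moreover have "\<bar>(-1) ^ k * ?T (\<tau> i)\<bar> < 1" using T[of "\<tau> i"] by (simp add: abs_mult abs_less_iff)
      ultimately show ?thesis by linarith
    qed
  qed
  then obtain Z where Z: "finite Z" "card Z = 2 * d + 2" "Z \<subseteq> {\<tau> 0<..<\<tau> (2 * d + 2)}"
    "\<And>z. z \<in> Z \<Longrightarrow> S z = 0" by blast
  have ends: "\<tau> (2 * d + 2) = \<alpha> + 2 * pi" "\<tau> 0 = \<alpha>" using d0 by (simp_all add: \<tau>_def)
  \<comment> \<open>All zeros lie in one open period, so the two functions agree everywhere. At
    \<open>\<alpha>\<close> this is absurd: the sine is -1 and the polynomial stays above
    -1.\<close>
  have "?T \<alpha> = sin (real d * \<alpha> + \<phi>)"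
  proof (rule trig_interpolation_unique[OF deg Z(1)])
    show "\<bar>a - b\<bar> < 2 * pi" if "a \<in> Z" "b \<in> Z" for a b
    proof -
      have "a \<in> {\<alpha><..<\<alpha> + 2 * pi}" "b \<in> {\<alpha><..<\<alpha> + 2 * pi}" using that Z(3) ends by auto
      then show ?thesis by auto
    qed
  qed (use Z S_def in auto)
  then show False using T[of \<alpha>] by (simp add: da)
qed

section \<open>Bernstein's inequality and comparison near a maximum\<close>

lemma arcsin_poly_cos_lipschitz:
  fixes p :: "real poly"
  assumes deg: "degree p \<le> d" and d: "d \<ge> 1"
    and bound: "\<And>x. \<bar>x\<bar> \<le> 1 \<Longrightarrow> \<bar>poly p x\<bar> < A"
  shows "\<bar>arcsin (poly p (cos t) / A) - arcsin (poly p (cos s) / A)\<bar> \<le> real d * \<bar>t - s\<bar>"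
proof -
  have A: "A > 0" using bound[of 0] by auto
  have *: "arcsin (poly p (cos t) / A) - arcsin (poly p (cos s) / A) \<le> real d * (t - s)
     \<and> arcsin (poly p (cos s) / A) - arcsin (poly p (cos t) / A) \<le> real d * (t - s)" if "s \<le> t" for s t
  proof
    have "arcsin (poly (smult (1/A) p) (cos t)) - arcsin (poly (smult (1/A) p) (cos s)) \<le> real d * (t - s)"
      by (rule arcsin_poly_cos_increase) (use assms that A in \<open>auto simp: abs_mult field_simps\<close>)
    then show "arcsin (poly p (cos t) / A) - arcsin (poly p (cos s) / A) \<le> real d * (t - s)" by simp
    \<comment> \<open>As the cosine is even, reflecting \<open>s\<close> and \<open>t\<close> lets
      the bound on increases bound decreases too.\<close>
    have "arcsin (poly (smult (1/A) p) (cos (-s))) - arcsin (poly (smult (1/A) p) (cos (-t))) \<le> real d * (-s - -t)"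
      by (rule arcsin_poly_cos_increase) (use assms that A in \<open>auto simp: abs_mult field_simps\<close>)
    then show "arcsin (poly p (cos s) / A) - arcsin (poly p (cos t) / A) \<le> real d * (t - s)" by simp
  qed
  show ?thesis using *[of s t] *[of t s] by (cases "s \<le> t") auto
qed

text \<open>Bernstein's inequality in integrated form. The sine is 1-Lipschitz, so the bound for the
  arcsine passes to \<open>poly p (cos t) / A\<close>, and \<open>A\<close> may be taken arbitrarily
  close to \<open>M\<close>.\<close>

lemma poly_cos_lipschitz:
  fixes p :: "real poly"
  assumes deg: "degree p \<le> d" and d: "d \<ge> 1"
    and bound: "\<And>x. \<bar>x\<bar> \<le> 1 \<Longrightarrow> \<bar>poly p x\<bar> \<le> M"
  shows "\<bar>poly p (cos t) - poly p (cos s)\<bar> \<le> real d * M * \<bar>t - s\<bar>"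
proof (rule field_le_epsilon)
  fix e :: real assume e: "e > 0"
  \<comment> \<open>The excess of \<open>A\<close> over \<open>M\<close>, times
    \<open>d * |t - s|\<close>, is below \<open>e\<close>; the 1 in the denominator covers
    \<open>s = t\<close>.\<close>
  define A where "A = M + e / (real d * \<bar>t - s\<bar> + 1)"
  have pos: "real d * \<bar>t - s\<bar> + 1 > 0" by (simp add: add_nonneg_pos)
  have AM: "A > M" using e pos by (simp add: A_def)
  moreover have "M \<ge> 0" using bound[of 0] by auto
  ultimately have A: "A > 0" by linarith
  have lt: "\<bar>poly p (cos t)\<bar> < A" for t using bound[of "cos t"] AM by auto
  have rng: "-1 \<le> poly p (cos t) / A \<and> poly p (cos t) / A \<le> 1" for t
    using lt[of t] A by (auto simp: field_simps)
  define u where "u = arcsin (poly p (cos t) / A)"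
  define v where "v = arcsin (poly p (cos s) / A)"
  have sin_uv: "sin u = poly p (cos t) / A" "sin v = poly p (cos s) / A"
    using rng by (auto simp: u_def v_def)
  have "\<bar>u - v\<bar> \<le> real d * \<bar>t - s\<bar>"
    unfolding u_def v_def
    by (rule arcsin_poly_cos_lipschitz[OF deg d]) (use bound AM in force)
  moreover have "\<bar>sin u - sin v\<bar> \<le> \<bar>u - v\<bar>"
  proof -
    have "\<bar>sin ((u - v) / 2)\<bar> * \<bar>cos ((u + v) / 2)\<bar> \<le> \<bar>(u - v) / 2\<bar> * 1"
      by (intro mult_mono abs_sin_x_le_abs_x) auto
    then show ?thesis by (simp add: sin_diff_sin abs_mult)
  qed
  ultimately have "\<bar>poly p (cos t) / A - poly p (cos s) / A\<bar> \<le> real d * \<bar>t - s\<bar>"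
    using sin_uv by simp
  then have "\<bar>poly p (cos t) - poly p (cos s)\<bar> \<le> A * (real d * \<bar>t - s\<bar>)"
    using A by (simp add: field_simps flip: diff_divide_distrib)
  also have "\<dots> = real d * M * \<bar>t - s\<bar> + e * (real d * \<bar>t - s\<bar> / (real d * \<bar>t - s\<bar> + 1))"
    by (simp add: A_def algebra_simps)
  also have "e * (real d * \<bar>t - s\<bar> / (real d * \<bar>t - s\<bar> + 1)) \<le> e * 1"
    using e pos by (intro mult_left_mono) (auto simp: field_simps)
  finally show "\<bar>poly p (cos t) - poly p (cos s)\<bar> \<le> real d * M * \<bar>t - s\<bar> + e" by simp
qed

text \<open>From its value at \<open>a\<close>, the arcsine of \<open>poly p (cos t) / A\<close> can
  fall by at most \<open>d * |t - a|\<close>. Taking sines bounds \<open>poly p (cos t)\<close> from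
  below, and letting \<open>A\<close> tend to \<open>M\<close> leaves the cosine.\<close>

lemma poly_cos_near_maximum:
  fixes p :: "real poly"
  assumes deg: "degree p \<le> d" and d: "d \<ge> 1"
    and bound: "\<And>x. \<bar>x\<bar> \<le> 1 \<Longrightarrow> \<bar>poly p x\<bar> \<le> M" and max: "poly p (cos a) = M"
    and near: "real d * \<bar>t - a\<bar> \<le> pi / 2"
  shows "M * cos (real d * \<bar>t - a\<bar>) \<le> poly p (cos t)"
proof (rule field_le_epsilon)
  fix e :: real assume e: "e > 0"
  define \<delta> where "\<delta> = real d * \<bar>t - a\<bar>"
  \<comment> \<open>This \<open>A > M\<close> makes the cosine of \<open>arcsin (M / A)\<close>
    exactly \<open>e / A\<close>, so the addition formula has error
    \<open>e * sin \<delta>\<close>.\<close>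
  define A where "A = sqrt (M\<^sup>2 + e\<^sup>2)"
  have M: "M \<ge> 0" using bound[of 0] by auto
  have AM: "A > M" using e M unfolding A_def by (intro real_less_rsqrt) simp
  with M have A: "A > 0" by linarith
  have lt: "\<bar>poly p (cos t)\<bar> < A" using bound[of "cos t"] AM by auto
  have rng: "-1 \<le> poly p (cos t) / A" "poly p (cos t) / A \<le> 1"
    using lt A by (auto simp: field_simps)
  have rngM: "0 \<le> M / A" "M / A \<le> 1" using A AM M by auto
  define u where "u = arcsin (poly p (cos t) / A)"
  define v where "v = arcsin (M / A)"
  have "\<bar>u - v\<bar> \<le> \<delta>"
    unfolding u_def v_def \<delta>_def max[symmetric]
    by (rule arcsin_poly_cos_lipschitz[OF deg d]) (use bound AM in force)
  have "cos v = e / A"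
  proof -
    have "1 - (M / A)\<^sup>2 = (e / A)\<^sup>2"
      using A by (simp add: power_divide diff_divide_eq_iff) (simp add: A_def)
    then show ?thesis using rngM A e by (simp add: v_def cos_arcsin)
  qed
  have "0 \<le> v" unfolding v_def using arcsin_le_arcsin[of 0 "M / A"] rngM by simp
  have "sin (v - \<delta>) \<le> sin u"
  proof (rule sin_monotone_2pi_le)
    \<comment> \<open>The assumption \<open>near\<close> keeps the lowered angle where the sine is
      increasing.\<close>
    show "- (pi / 2) \<le> v - \<delta>" using \<open>0 \<le> v\<close> near \<delta>_def by linarith
    show "v - \<delta> \<le> u" using \<open>\<bar>u - v\<bar> \<le> \<delta>\<close> by linarith
    show "u \<le> pi / 2" unfolding u_def using rng by (intro arcsin_ubound)
  qed
  then have "M / A * cos \<delta> - e / A * sin \<delta> \<le> poly p (cos t) / A"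
    using \<open>cos v = e / A\<close> rng rngM by (simp add: sin_diff u_def v_def)
  then have "M * cos \<delta> - e * sin \<delta> \<le> poly p (cos t)"
    using A by (simp add: divide_le_cancel flip: diff_divide_distrib)
  moreover have "e * sin \<delta> \<le> e * 1" using e by (intro mult_left_mono) auto
  ultimately show "M * cos (real d * \<bar>t - a\<bar>) \<le> poly p (cos t) + e" by (simp add: \<delta>_def)
qed

section \<open>Cosine inequalities and the bound from equispaced points\<close>

lemma abs_sin_nat_mult_le: "\<bar>sin (real d * x)\<bar> \<le> real d * \<bar>sin x\<bar>"
proof (induction d)
  case (Suc d)
  have "\<bar>sin (real (Suc d) * x)\<bar> = \<bar>sin (real d * x) * cos x + cos (real d * x) * sin x\<bar>"
    by (simp add: algebra_simps sin_add)
  also have "\<dots> \<le> \<bar>sin (real d * x)\<bar> * \<bar>cos x\<bar> + \<bar>cos (real d * x)\<bar> * \<bar>sin x\<bar>"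
    by (metis abs_mult abs_triangle_ineq)
  also have "\<dots> \<le> \<bar>sin (real d * x)\<bar> * 1 + 1 * \<bar>sin x\<bar>"
    by (intro add_mono mult_mono) auto
  finally show ?case using Suc by (simp add: algebra_simps)
qed simp

lemma one_minus_cos_nat_mult_le: "1 - cos (real d * x) \<le> (real d)\<^sup>2 * (1 - cos x)"
proof -
  have c: "1 - cos y = 2 * (sin (y / 2))\<^sup>2" for y :: real
    using cos_double_sin[of "y / 2"] by simp
  have "(sin (real d * (x / 2)))\<^sup>2 \<le> (real d * \<bar>sin (x / 2)\<bar>)\<^sup>2"
    using power_mono[OF abs_sin_nat_mult_le[of d "x / 2"], of 2] by simp
  then show ?thesis unfolding c by (simp add: power_mult_distrib)
qed

text \<open>Turns a distance in [-1,1] into a bound on the angle, uniformly up to the endpoints. If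
  \<open>sin t\<close> is the smaller sine, then \<open>sin t * sin s\<close> is at least its
  square, which leaves \<open>cos t * (cos t - cos s)\<close>.\<close>

lemma one_minus_cos_diff_le:
  assumes "0 \<le> s" "s \<le> pi" "0 \<le> t" "t \<le> pi"
  shows "1 - cos (t - s) \<le> \<bar>cos t - cos s\<bar>"
proof -
  have *: "1 - cos (t - s) \<le> \<bar>cos t - cos s\<bar>"
    if "0 \<le> sin t" "sin t \<le> sin s" for s t :: real
  proof -
    have "sin t * sin t \<le> sin t * sin s" using that by (intro mult_left_mono) auto
    then have "1 - cos (t - s) \<le> 1 - cos t * cos s - (sin t)\<^sup>2"
      by (simp add: cos_diff power2_eq_square)
    also have "\<dots> = cos t * (cos t - cos s)" by (simp add: sin_squared_eq power2_eq_square algebra_simps)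
    also have "\<dots> \<le> \<bar>cos t\<bar> * \<bar>cos t - cos s\<bar>" by (metis abs_ge_self abs_mult)
    also have "\<dots> \<le> 1 * \<bar>cos t - cos s\<bar>" by (intro mult_right_mono) auto
    finally show ?thesis by simp
  qed
  have "0 \<le> sin s" "0 \<le> sin t" using assms by (auto intro: sin_ge_zero)
  then show ?thesis using *[of t s] *[of s t] cos_minus[of "t - s"]
    by (cases "sin t \<le> sin s") (auto simp: abs_minus_commute)
qed

lemma near_equispaced_point:
  fixes x :: real
  assumes "\<bar>x\<bar> \<le> 1" "n > 0"
  obtains k where "k \<le> n" "\<bar>(2 * real k - real n) / real n - x\<bar> \<le> 1 / real n"
proof -
  \<comment> \<open>The real index at which the grid would hit \<open>x\<close>. Neighbouring grid
    points are \<open>2 / n\<close> apart, so rounding the index moves the point by at most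
    \<open>1 / n\<close>.\<close>
  define y where "y = (x + 1) * real n / 2"
  define r where "r = round y"
  have r: "\<bar>real_of_int r - y\<bar> \<le> 1 / 2" unfolding r_def by (rule of_int_round_abs_le)
  have "0 \<le> y" using assms by (simp add: y_def)
  moreover have "(x + 1) * real n \<le> 2 * real n" using assms by (intro mult_right_mono) auto
  then have "y \<le> real n" by (simp add: y_def)
  ultimately have "0 \<le> r" "r \<le> int n" using r by linarith+
  then have k: "real (nat r) = real_of_int r" "nat r \<le> n" by auto
  have "(2 * real (nat r) - real n) / real n - x = 2 * (real_of_int r - y) / real n"
    using assms k by (simp add: y_def field_simps)
  also have "\<bar>\<dots>\<bar> \<le> 1 / real n"
    using r unfolding abs_divide abs_of_nat abs_mult by (intro divide_right_mono) auto
  finally show ?thesis using that k by blast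
qed

text \<open>Let the absolute value attain its maximum \<open>M\<close> at \<open>cos a\<close>. A
  grid point \<open>cos t\<close> within \<open>1 / n\<close> of it has
  \<open>1 - cos (t - a) \<le> 1 / n\<close>, hence
  \<open>cos (d * |t - a|) \<ge> 1 - d^2 / n\<close>, and comparison near the maximum gives
  \<open>M * (1 - d^2 / n) \<le> 1\<close>.\<close>

lemma poly_bound_from_equispaced:
  fixes p :: "real poly"
  assumes deg: "degree p \<le> d" and d: "d \<ge> 1" and dn: "(real d)\<^sup>2 < real n"
    and grid: "\<And>k. k \<le> n \<Longrightarrow> \<bar>poly p ((2 * real k - real n) / real n)\<bar> \<le> 1"
    and x: "\<bar>x\<bar> \<le> 1"
  shows "\<bar>poly p x\<bar> \<le> real n / (real n - (real d)\<^sup>2)"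
proof -
  have n: "n > 0" using dn by (cases n) auto
  have "\<exists>m\<in>{-1..1}. \<forall>y\<in>{-1..1}. \<bar>poly p y\<bar> \<le> \<bar>poly p m\<bar>"
    by (rule continuous_attains_sup) (auto intro!: continuous_intros)
  then obtain m where m: "\<bar>m\<bar> \<le> 1" "\<And>y. \<bar>y\<bar> \<le> 1 \<Longrightarrow> \<bar>poly p y\<bar> \<le> \<bar>poly p m\<bar>"
    by (auto simp: abs_le_iff)
  define M where "M = \<bar>poly p m\<bar>"
  \<comment> \<open>The sign is chosen so that \<open>q\<close> itself takes the value
    \<open>M\<close> at \<open>m\<close>.\<close>
  define q where "q = (if poly p m \<ge> 0 then p else - p)"
  have q: "degree q \<le> d" "\<bar>poly q y\<bar> = \<bar>poly p y\<bar>" "poly q m = M" for y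
    using deg by (auto simp: q_def M_def)
  obtain k where k: "k \<le> n" "\<bar>(2 * real k - real n) / real n - m\<bar> \<le> 1 / real n"
    using near_equispaced_point[OF m(1) n] .
  define g where "g = (2 * real k - real n) / real n"
  have g: "\<bar>g\<bar> \<le> 1" using k n by (simp add: g_def abs_le_iff field_simps)
  define t where "t = arccos g"
  define a where "a = arccos m"
  have cos: "cos t = g" "cos a = m" using g m by (auto simp: t_def a_def cos_arccos_abs)
  have rng: "0 \<le> t" "t \<le> pi" "0 \<le> a" "a \<le> pi"
    using g m arccos_bounded[of g] arccos_bounded[of m] by (auto simp: t_def a_def abs_le_iff)
  have "1 - cos \<bar>t - a\<bar> \<le> \<bar>cos t - cos a\<bar>"
    using one_minus_cos_diff_le[of a t] rng by simp
  also have "\<dots> \<le> 1 / real n" using k cos by (simp add: g_def)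
  finally have small: "(real d)\<^sup>2 * (1 - cos \<bar>t - a\<bar>) \<le> (real d)\<^sup>2 / real n"
    using mult_left_mono[of "1 - cos \<bar>t - a\<bar>" "1 / real n" "(real d)\<^sup>2"] by simp
  have d1: "(real d)\<^sup>2 / real n < 1" using dn n by simp
  \<comment> \<open>At \<open>pi / (2 * d)\<close> the function \<open>cos (d * x)\<close> vanishes
    and \<open>1 - cos x\<close> is already at least \<open>1 / d^2\<close>; a larger angle would
    contradict \<open>d^2 < n\<close>.\<close>
  have near: "real d * \<bar>t - a\<bar> \<le> pi / 2"
  proof (rule ccontr)
    assume "\<not> ?thesis"
    then have lt: "pi / (2 * real d) < \<bar>t - a\<bar>" using d by (simp add: field_simps)
    have "cos \<bar>t - a\<bar> < cos (pi / (2 * real d))"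
      by (rule cos_monotone_0_pi) (use lt rng in auto)
    moreover have "1 \<le> (real d)\<^sup>2 * (1 - cos (pi / (2 * real d)))"
      using one_minus_cos_nat_mult_le[of d "pi / (2 * real d)"] d by simp
    ultimately have "1 \<le> (real d)\<^sup>2 * (1 - cos \<bar>t - a\<bar>)"
      by (smt (verit, best) mult_left_mono zero_le_power2)
    then show False using small d1 by linarith
  qed
  have "M * (1 - (real d)\<^sup>2 / real n) \<le> M * cos (real d * \<bar>t - a\<bar>)"
    using one_minus_cos_nat_mult_le[of d "\<bar>t - a\<bar>"] small
    by (intro mult_left_mono) (auto simp: M_def)
  also have "\<dots> \<le> poly q (cos t)"
    by (rule poly_cos_near_maximum[OF q(1) d _ _ near]) (use q m cos in \<open>auto simp: M_def\<close>)
  also have "\<dots> \<le> \<bar>poly p g\<bar>" using q(2)[of g] cos by (metis abs_ge_self)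
  also have "\<dots> \<le> 1" using grid[OF k(1)] by (simp add: g_def)
  finally have "M * (real n - (real d)\<^sup>2) \<le> real n" using n by (simp add: field_simps)
  then have "M \<le> real n / (real n - (real d)\<^sup>2)" using dn by (simp add: field_simps)
  then show ?thesis using m(2)[OF x] by (simp add: M_def)
qed

text \<open>The derivative is at most \<open>1 / sqrt (1 - w)\<close> in absolute value, and this is
  at most \<open>1 + w\<close> for \<open>w \<le> 3 / 5\<close>.\<close>

lemma arccos_lipschitz:
  assumes w: "w \<le> 3 / 5" and xy: "x\<^sup>2 \<le> w" "y\<^sup>2 \<le> w"
  shows "\<bar>arccos x - arccos y\<bar> \<le> (1 + w) * \<bar>x - y\<bar>"
proof -
  have w0: "0 \<le> w" using xy(1) by (meson order.trans zero_le_power2)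
  have "norm (arccos x - arccos y) \<le> (1 + w) * norm (x - y)"
  proof (rule field_differentiable_bound)
    show "convex {- sqrt w..sqrt w}" by simp
    fix z assume "z \<in> {- sqrt w..sqrt w}"
    then have "\<bar>z\<bar> \<le> sqrt w" by auto
    then have z2: "z\<^sup>2 \<le> w" using w0 by (metis abs_ge_zero power2_abs power_mono real_sqrt_pow2)
    then have "z\<^sup>2 < 1" using w by linarith
    then have "\<bar>z\<bar> < 1" by (simp add: abs_square_less_1)
    then show "(arccos has_field_derivative inverse (- sqrt (1 - z\<^sup>2))) (at z within {- sqrt w..sqrt w})"
      by (intro has_field_derivative_at_within[OF DERIV_arccos]) auto
    \<comment> \<open>The product equals \<open>(1 + w)^2 * (1 - w) - 1\<close>; its last factor is
      positive because \<open>3 / 5 + 9 / 25 < 1\<close>.\<close>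
    have "0 \<le> w * (1 - w - w * w)"
      using w w0 mult_mono[OF w w] by (intro mult_nonneg_nonneg) auto
    then have "1 \<le> (1 + w)\<^sup>2 * (1 - w)" by (simp add: power2_eq_square algebra_simps)
    also have "\<dots> \<le> (1 + w)\<^sup>2 * (1 - z\<^sup>2)" using z2 by (intro mult_left_mono) auto
    finally have "1 \<le> sqrt ((1 + w)\<^sup>2 * (1 - z\<^sup>2))" by simp
    also have "\<dots> = (1 + w) * sqrt (1 - z\<^sup>2)" using w0 by (simp add: real_sqrt_mult)
    finally show "norm (inverse (- sqrt (1 - z\<^sup>2))) \<le> 1 + w"
      using \<open>z\<^sup>2 < 1\<close> by (simp add: field_simps)
  next
    show "x \<in> {- sqrt w..sqrt w}" "y \<in> {- sqrt w..sqrt w}"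
      using xy real_le_rsqrt[of "\<bar>x\<bar>" w] real_le_rsqrt[of "\<bar>y\<bar>" w] by (auto simp: abs_le_iff)
  qed
  then show ?thesis by simp
qed

section \<open>Symmetric functions on the cube\<close>

text \<open>The coefficients of this generating function are the elementary symmetric polynomials. On the
  cube, x i * x i = 1 turns its logarithmic derivative into the differential equation below, which
  makes them polynomials in the coordinate sum.\<close>

definition cube_gf :: "nat \<Rightarrow> (nat \<Rightarrow> real) \<Rightarrow> real poly" where
  "cube_gf n x = (\<Prod>i<n. [:1, x i:])"

lemma coeff_cube_gf:
  "coeff (cube_gf n x) k = (\<Sum>S | S \<subseteq> {..<n} \<and> card S = k. \<Prod>i\<in>S. x i)"
proof -
  have mon: "(\<Prod>i\<in>S. [:0, x i:]) = monom (\<Prod>i\<in>S. x i) (card S)" if "finite S" for S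
    using that by induction (auto simp: monom_Suc smult_monom)
  have "cube_gf n x = (\<Prod>i<n. [:0, x i:] + 1)"
    unfolding cube_gf_def by (intro prod.cong) (auto simp: one_pCons)
  also have "\<dots> = (\<Sum>S\<in>Pow {..<n}. monom (\<Prod>i\<in>S. x i) (card S))"
    by (subst prod_add) (auto intro!: sum.cong mon finite_subset[of _ "{..<n}"])
  finally have "coeff (cube_gf n x) k = (\<Sum>S\<in>Pow {..<n}. if card S = k then \<Prod>i\<in>S. x i else 0)"
    by (simp add: coeff_sum)
  also have "\<dots> = (\<Sum>S\<in>{S \<in> Pow {..<n}. card S = k}. \<Prod>i\<in>S. x i)"
    by (subst sum.inter_filter) auto
  finally show ?thesis by simp
qed

text \<open>Since \<open>x a\<close> is 1 or -1,
  \<open>(1 - z^2) * x a = (x a - z) * (1 + x a * z)\<close>, so every term of the product rule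
  regains its missing factor.\<close>

lemma cube_gf_differential_equation:
  assumes "x \<in> cube n"
  shows "[:1, 0, -1:] * pderiv (cube_gf n x) = [:\<Sum>i<n. x i, - real n:] * cube_gf n x"
proof -
  have "[:1, 0, -1:] * pderiv (cube_gf n x)
      = (\<Sum>a<n. [:1, 0, -1:] * ((\<Prod>i\<in>{..<n} - {a}. [:1, x i:]) * [:x a:]))"
    unfolding cube_gf_def pderiv_prod by (simp add: sum_distrib_left pderiv_pCons)
  also have "\<dots> = (\<Sum>a<n. [:x a, -1:] * cube_gf n x)"
  proof (rule sum.cong)
    fix a assume a: "a \<in> {..<n}"
    then have "x a = -1 \<or> x a = 1" using assms by (auto simp: cube_def PiE_iff)
    then have 1: "[:1, 0, -1:] * [:x a:] = [:x a, -1:] * [:1, x a:]" by auto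
    have 2: "cube_gf n x = [:1, x a:] * (\<Prod>i\<in>{..<n} - {a}. [:1, x i:])" (is "_ = _ * ?R")
      unfolding cube_gf_def using a by (intro prod.remove) auto
    have "[:1, 0, -1:] * (?R * [:x a:]) = ([:1, 0, -1:] * [:x a:]) * ?R" by (simp only: mult_ac)
    also have "\<dots> = [:x a, -1:] * cube_gf n x" unfolding 1 2 by (simp only: mult.assoc)
    finally show "[:1, 0, -1:] * (?R * [:x a:]) = [:x a, -1:] * cube_gf n x" .
  qed simp
  also have "\<dots> = (\<Sum>a<n. [:x a, -1:]) * cube_gf n x"
    by (simp only: sum_distrib_right)
  also have "(\<Sum>a<n. [:x a, -1:]) = [:\<Sum>i<n. x i, - real n:]"
    by (induction n) (auto simp: algebra_simps)
  finally show ?thesis .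
qed

text \<open>Apart from the constant term, these compare coefficients in the differential equation,
  at degrees 0 and \<open>Suc j\<close>.\<close>

lemma coeff_cube_gf_recurrence:
  assumes "x \<in> cube n"
  shows "coeff (cube_gf n x) 0 = 1" "coeff (cube_gf n x) (Suc 0) = (\<Sum>i<n. x i)"
    "real (j + 2) * coeff (cube_gf n x) (j + 2)
      = (\<Sum>i<n. x i) * coeff (cube_gf n x) (Suc j) - (real n - real j) * coeff (cube_gf n x) j"
proof -
  let ?E = "cube_gf n x" and ?s = "\<Sum>i<n. x i"
  have eq: "coeff ([:1, 0, -1:] * pderiv ?E) k = coeff ([:?s, - real n:] * ?E) k" for k
    by (simp only: cube_gf_differential_equation[OF assms])
  show 0: "coeff ?E 0 = 1"
    unfolding cube_gf_def by (simp flip: poly_0_coeff_0 add: poly_prod)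
  show "coeff ?E (Suc 0) = ?s" using eq[of 0] 0 by (simp add: coeff_pderiv)
  show "real (j + 2) * coeff ?E (j + 2) = ?s * coeff ?E (Suc j) - (real n - real j) * coeff ?E j"
    using eq[of "Suc j"] by (cases j) (simp_all add: coeff_pderiv algebra_simps)
qed

text \<open>Induction by the recurrence, where the factor \<open>\<Sum>i<n. x i\<close> raises the
  degree by one. One \<open>r\<close> serves all points; the polynomial so built is a Krawtchouk
  polynomial up to an affine change of variable.\<close>

lemma coeff_cube_gf_poly:
  "\<exists>r. degree r \<le> k \<and> (\<forall>x\<in>cube n. coeff (cube_gf n x) k = poly r (\<Sum>i<n. x i))"
proof (induction k rule: less_induct)
  case (less k)
  consider "k = 0" | "k = Suc 0" | j where "k = j + 2"
    by (metis One_nat_def add_2_eq_Suc' not0_implies_Suc)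
  then show ?case
  proof cases
    case 1
    then show ?thesis
      by (intro exI[of _ 1]) (simp add: coeff_cube_gf_recurrence(1))
  next
    case 2
    then show ?thesis
      by (intro exI[of _ "[:0, 1:]"]) (simp add: coeff_cube_gf_recurrence(2))
  next
    case 3
    obtain a where a: "degree a \<le> Suc j"
      "\<And>x. x \<in> cube n \<Longrightarrow> coeff (cube_gf n x) (Suc j) = poly a (\<Sum>i<n. x i)"
      using less[of "Suc j"] 3 by auto
    obtain b where b: "degree b \<le> j"
      "\<And>x. x \<in> cube n \<Longrightarrow> coeff (cube_gf n x) j = poly b (\<Sum>i<n. x i)"
      using less[of j] 3 by auto
    define r where "r = smult (1 / real (j + 2)) ([:0, 1:] * a - smult (real n - real j) b)"
    have "degree ([:0, 1:] * a) \<le> k"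
      using degree_mult_le[of "[:0, 1:]" a] a 3 by simp
    moreover have "degree (smult (real n - real j) b) \<le> k"
      using b 3 by simp
    ultimately have "degree ([:0, 1:] * a - smult (real n - real j) b) \<le> k"
      by (rule degree_diff_le)
    then have "degree r \<le> k"
      unfolding r_def by (rule order.trans[OF degree_smult_le])
    moreover have "coeff (cube_gf n x) k = poly r (\<Sum>i<n. x i)" if "x \<in> cube n" for x
      using coeff_cube_gf_recurrence(3)[OF that, of j] a(2)[OF that] b(2)[OF that] 3
      by (simp add: r_def field_simps)
    ultimately show ?thesis by blast
  qed
qed

text \<open>A permutation of the coordinates that carries \<open>S\<close> to \<open>S'\<close>
  preserves \<open>f\<close>; reindexing the cube by it turns the averaging formula for one
  coefficient into that for the other.\<close>

lemma symmetric_coeffs_eq: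
  assumes sym: "symmetric_on_cube n f" and S: "S \<subseteq> {..<n}" "S' \<subseteq> {..<n}" "card S = card S'"
  shows "multilinear_coeffs n f S = multilinear_coeffs n f S'"
proof -
  have fin: "finite S" "finite S'" using S finite_subset by blast+
  obtain h1 where h1: "bij_betw h1 S S'" using finite_same_card_bij[OF fin S(3)] by blast
  have "card ({..<n} - S) = card ({..<n} - S')" using S fin by (simp add: card_Diff_subset)
  then obtain h2 where h2: "bij_betw h2 ({..<n} - S) ({..<n} - S')"
    using finite_same_card_bij[of "{..<n} - S" "{..<n} - S'"] by auto
  define h where "h i = (if i \<in> S then h1 i else h2 i)" for i
  have hS: "bij_betw h S S'" using h1 by (rule bij_betw_cong[THEN iffD1, rotated]) (simp add: h_def)
  have "bij_betw h ({..<n} - S) ({..<n} - S')"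
    using h2 by (rule bij_betw_cong[THEN iffD1, rotated]) (simp add: h_def)
  with hS have "bij_betw h (S \<union> ({..<n} - S)) (S' \<union> ({..<n} - S'))"
    by (rule bij_betw_combine) auto
  then have h: "bij_betw h {..<n} {..<n}" using S by (simp add: Un_absorb1)
  \<comment> \<open>The restriction keeps the permuted point extensional, as \<open>cube n\<close>
    demands.\<close>
  define \<pi> where "\<pi> x = restrict (\<lambda>i. x (h i)) {..<n}" for x :: "nat \<Rightarrow> real"
  have hn: "h i < n" if "i < n" for i using h that by (auto simp: bij_betw_def)
  have \<pi>_cube: "\<pi> x \<in> cube n" if "x \<in> cube n" for x
    using that hn unfolding cube_def \<pi>_def by (intro restrict_PiE_iff[THEN iffD2]) (auto simp: PiE_iff)
  have "inj_on \<pi> (cube n)"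
  proof (rule inj_onI)
    fix x y assume xy: "x \<in> cube n" "y \<in> cube n" "\<pi> x = \<pi> y"
    have "x i = y i" if "i < n" for i
    proof -
      have "i \<in> h ` {..<n}" using bij_betw_imp_surj_on[OF h] that by simp
      then obtain j where "j < n" "i = h j" by (elim imageE) simp
      then show ?thesis using fun_cong[OF xy(3), of j] by (simp add: \<pi>_def)
    qed
    then show "x = y" using xy PiE_ext[of x "{..<n}" "\<lambda>_. {-1,1}" y] by (auto simp: cube_def)
  qed
  then have bij: "bij_betw \<pi> (cube n) (cube n)"
    using endo_inj_surj[OF finite_cube, of \<pi>] \<pi>_cube by (auto simp: bij_betw_def)
  have f\<pi>: "f (\<pi> x) = f x" if "x \<in> cube n" for x
  proof -
    have "(\<Sum>i<n. \<pi> x i) = (\<Sum>i<n. x (h i))" by (simp add: \<pi>_def)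
    also have "\<dots> = (\<Sum>i<n. x i)" using sum.reindex_bij_betw[OF h] .
    finally show ?thesis using sym that \<pi>_cube unfolding symmetric_on_cube_def by blast
  qed
  have \<chi>: "(\<Prod>i\<in>S. \<pi> x i) = (\<Prod>i\<in>S'. x i)" for x
  proof -
    have "(\<Prod>i\<in>S. \<pi> x i) = (\<Prod>i\<in>S. x (h i))"
      using S(1) by (intro prod.cong) (auto simp: \<pi>_def)
    also have "\<dots> = (\<Prod>i\<in>S'. x i)" using prod.reindex_bij_betw[OF hS] .
    finally show ?thesis .
  qed
  have "(\<Sum>x\<in>cube n. f x * (\<Prod>i\<in>S. x i)) = (\<Sum>x\<in>cube n. f (\<pi> x) * (\<Prod>i\<in>S. \<pi> x i))"
    using sum.reindex_bij_betw[OF bij, of "\<lambda>x. f x * (\<Prod>i\<in>S. x i)"] by simp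
  also have "\<dots> = (\<Sum>x\<in>cube n. f x * (\<Prod>i\<in>S'. x i))" by (simp add: f\<pi> \<chi>)
  finally show ?thesis
    by (simp only: represents_coeff[OF represents_multilinear_coeffs S(1)]
      represents_coeff[OF represents_multilinear_coeffs S(2)])
qed

text \<open>Coefficients depend only on the size of the set, so \<open>f\<close> is a combination of
  elementary symmetric polynomials, the one of order \<open>k\<close> having degree at most
  \<open>k\<close> in the coordinate sum. Orders above the degree of \<open>f\<close> have
  coefficient 0.\<close>

lemma symmetric_as_poly_of_sum:
  assumes sym: "symmetric_on_cube n f"
  shows "\<exists>p. degree p \<le> cube_degree n f \<and> (\<forall>x\<in>cube n. f x = poly p (\<Sum>i<n. x i))"
proof -
  define c where "c = multilinear_coeffs n f"
  \<comment> \<open>The set \<open>{..<k}\<close> represents all sets of size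
    \<open>k\<close>.\<close>
  define \<gamma> where "\<gamma> k = c {..<k}" for k
  obtain r where r: "\<And>k. degree (r k) \<le> k"
    "\<And>k x. x \<in> cube n \<Longrightarrow> coeff (cube_gf n x) k = poly (r k) (\<Sum>i<n. x i)"
    using coeff_cube_gf_poly[of _ n] by metis
  define p where "p = (\<Sum>k\<le>n. smult (\<gamma> k) (r k))"
  have "degree p \<le> cube_degree n f"
    unfolding p_def
  proof (rule degree_sum_le)
    fix k assume k: "k \<in> {..n}"
    show "degree (smult (\<gamma> k) (r k)) \<le> cube_degree n f"
    proof (cases "\<gamma> k = 0")
      case False
      have "k = card {..<k}" by simp
      then have "k \<in> card ` {S. S \<subseteq> {..<n} \<and> c S \<noteq> 0}"
        using k False by (intro image_eqI[of _ _ "{..<k}"]) (auto simp: \<gamma>_def)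
      then have "k \<le> cube_degree n f"
        unfolding cube_degree_def c_def by (intro Max_ge) auto
      then show ?thesis using r(1)[of k] by (simp add: False)
    qed simp
  qed simp
  moreover have "f x = poly p (\<Sum>i<n. x i)" if x: "x \<in> cube n" for x
  proof -
    have "f x = (\<Sum>S\<in>Pow {..<n}. c S * (\<Prod>i\<in>S. x i))"
      using represents_multilinear_coeffs[of n f] x by (simp add: represents_def multilinear_eval_def c_def)
    also have "\<dots> = (\<Sum>k\<le>n. \<Sum>S | S \<in> Pow {..<n} \<and> card S = k. c S * (\<Prod>i\<in>S. x i))"
      by (rule sum.group[symmetric]) (use card_mono[of "{..<n}"] in auto)
    also have "\<dots> = (\<Sum>k\<le>n. \<gamma> k * coeff (cube_gf n x) k)"
    proof (rule sum.cong)
      fix k assume k: "k \<in> {..n}"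
      have "c S = \<gamma> k" if "S \<subseteq> {..<n}" "card S = k" for S
        unfolding c_def \<gamma>_def using k that by (intro symmetric_coeffs_eq[OF sym]) auto
      then show "(\<Sum>S | S \<in> Pow {..<n} \<and> card S = k. c S * (\<Prod>i\<in>S. x i)) = \<gamma> k * coeff (cube_gf n x) k"
        by (simp add: coeff_cube_gf sum_distrib_left)
    qed simp
    also have "\<dots> = poly p (\<Sum>i<n. x i)" using x by (simp add: p_def poly_sum r(2))
    finally show ?thesis .
  qed
  ultimately show ?thesis by blast
qed

section \<open>Moments of the coordinate sum\<close>

lemma sum_cube_Suc:
  "(\<Sum>x\<in>cube (Suc n). F (\<Sum>i<Suc n. x i)) = (\<Sum>x\<in>cube n. F ((\<Sum>i<n. x i) + 1) + F ((\<Sum>i<n. x i) - 1))"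
proof -
  have inj: "inj_on (\<lambda>(y, g). g(n := y)) ({-1, 1} \<times> cube n)"
    unfolding cube_def by (intro inj_combinator) simp
  have cube: "cube (Suc n) = (\<lambda>(y, g). g(n := y)) ` ({-1, 1} \<times> cube n)"
    unfolding cube_def lessThan_Suc by (rule PiE_insert_eq)
  have "(\<Sum>x\<in>cube (Suc n). F (\<Sum>i<Suc n. x i))
      = (\<Sum>y\<in>{-1, 1}. \<Sum>x\<in>cube n. F ((\<Sum>i<n. x i) + y))"
    unfolding cube sum.reindex[OF inj] by (simp add: sum.cartesian_product case_prod_unfold)
  then show ?thesis by (simp add: sum.distrib add.commute)
qed

lemma sum_cube_moments:
  "(\<Sum>x\<in>cube n. (\<Sum>i<n. x i)\<^sup>2) = 2 ^ n * real n"
  "(\<Sum>x\<in>cube n. (\<Sum>i<n. x i) ^ 4) = 2 ^ n * (3 * (real n)\<^sup>2 - 2 * real n)"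
proof -
  show m2: "(\<Sum>x\<in>cube n. (\<Sum>i<n. x i)\<^sup>2) = 2 ^ n * real n" for n
  proof (induction n)
    case (Suc n)
    have "(\<Sum>x\<in>cube (Suc n). (\<Sum>i<Suc n. x i)\<^sup>2) = (\<Sum>x\<in>cube n. 2 * (\<Sum>i<n. x i)\<^sup>2 + 2)"
      unfolding sum_cube_Suc[where F = "\<lambda>s. s\<^sup>2"]
      by (intro sum.cong) (auto simp: power2_eq_square algebra_simps)
    then show ?case using Suc by (simp add: sum.distrib card_cube algebra_simps flip: sum_distrib_left)
  qed simp
  show "(\<Sum>x\<in>cube n. (\<Sum>i<n. x i) ^ 4) = 2 ^ n * (3 * (real n)\<^sup>2 - 2 * real n)"
  proof (induction n)
    case (Suc n)
    \<comment> \<open>Odd powers cancel between the two values of the last coordinate: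
      \<open>(s + 1)^4 + (s - 1)^4 = 2 * s^4 + 12 * s^2 + 2\<close>.\<close>
    have "(\<Sum>x\<in>cube (Suc n). (\<Sum>i<Suc n. x i) ^ 4)
        = (\<Sum>x\<in>cube n. 2 * (\<Sum>i<n. x i) ^ 4 + 12 * (\<Sum>i<n. x i)\<^sup>2 + 2)"
      unfolding sum_cube_Suc[where F = "\<lambda>s. s ^ 4"]
      by (intro sum.cong) (auto simp: power2_eq_square power4_eq_xxxx algebra_simps)
    also have "\<dots> = 2 * (\<Sum>x\<in>cube n. (\<Sum>i<n. x i) ^ 4) + 12 * (\<Sum>x\<in>cube n. (\<Sum>i<n. x i)\<^sup>2) + 2 * 2 ^ n"
      by (simp add: sum.distrib card_cube sum_distrib_left)
    finally show ?case unfolding Suc m2 by (simp add: algebra_simps power2_eq_square)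
  qed simp
qed

section \<open>Influence\<close>

text \<open>Makes each equispaced point the mean of a cube point, so that the bound on
  \<open>f\<close> bounds the polynomial there.\<close>

lemma cube_point_with_sum:
  assumes "k \<le> n"
  obtains x where "x \<in> cube n" "(\<Sum>i<n. x i) = 2 * real k - real n"
proof
  let ?x = "restrict (\<lambda>i. if i < k then 1 else -1 :: real) {..<n}"
  show "?x \<in> cube n" by (auto simp: cube_def)
  have "{..<n} \<inter> {i. i < k} = {..<k}" "{..<n} \<inter> - {i. i < k} = {k..<n}" using assms by auto
  then show "(\<Sum>i<n. ?x i) = 2 * real k - real n"
    using assms by (simp add: sum.If_cases of_nat_diff)
qed

lemma cube_abs_coord:
  assumes "x \<in> cube n" "i < n"
  shows "\<bar>x i\<bar> = 1"
proof -
  have "x i \<in> {-1, 1}" using assms(1)[unfolded cube_def, THEN PiE_mem, of i] assms(2) by simp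
  then have "x i = -1 \<or> x i = 1" by simp
  then show ?thesis by (elim disjE) simp_all
qed

lemma cube_abs_sum_le:
  assumes "x \<in> cube n"
  shows "\<bar>\<Sum>i<n. x i\<bar> \<le> real n"
proof -
  have "\<bar>\<Sum>i<n. x i\<bar> \<le> (\<Sum>i<n. \<bar>x i\<bar>)" by (rule sum_abs)
  also have "\<dots> = real n" using cube_abs_coord[OF assms] by simp
  finally show ?thesis .
qed

lemma sum_flip:
  assumes "i < n"
  shows "(\<Sum>j<n. flip x i j) = (\<Sum>j<n. x j) - 2 * x i"
proof -
  have "(\<Sum>j<n. flip x i j) = - x i + (\<Sum>j\<in>{..<n} - {i}. flip x i j)"
    using assms by (subst sum.remove[of _ i]) (auto simp: flip_def)
  also have "(\<Sum>j\<in>{..<n} - {i}. flip x i j) = (\<Sum>j\<in>{..<n} - {i}. x j)"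
    by (rule sum.cong) (auto simp: flip_def)
  also have "\<dots> = (\<Sum>j<n. x j) - x i"
    using assms by (simp add: sum_diff1)
  finally show ?thesis by simp
qed

text \<open>For \<open>|a| \<le> 1 / 2\<close>, Bernstein's inequality in the angle combines with
  the Lipschitz bound for \<open>arccos\<close>. Otherwise the trivial bound 1 is at most
  \<open>16 * a ^ 4\<close>, a form that the fourth moment can average.\<close>

lemma poly_step_bound:
  fixes p :: "real poly"
  assumes deg: "degree p \<le> d" and d: "d \<ge> 1" and n: "n \<ge> 9"
    and bound: "\<And>x. \<bar>x\<bar> \<le> 1 \<Longrightarrow> \<bar>poly p x\<bar> \<le> M"
    and ab: "\<bar>a\<bar> \<le> 1" "\<bar>b\<bar> \<le> 1" "\<bar>a - b\<bar> = 2 / real n" "\<bar>poly p a\<bar> \<le> 1" "\<bar>poly p b\<bar> \<le> 1"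
  shows "\<bar>(poly p a - poly p b) / 2\<bar> \<le> real d * M / real n * (1 + (2 * a\<^sup>2 + 8 / (real n)\<^sup>2)) + 16 * a ^ 4"
proof -
  define w where "w = 2 * a\<^sup>2 + 8 / (real n)\<^sup>2"
  have M: "M \<ge> 0" using bound[of 0] by auto
  have w0: "w \<ge> 0" by (simp add: w_def)
  have "\<bar>(poly p a - poly p b) / 2\<bar> \<le> real d * M / real n * (1 + w) + 16 * a ^ 4"
  proof (cases "\<bar>a\<bar> \<le> 1 / 2")
    case True
    then have a2: "a\<^sup>2 \<le> 1 / 4" using power_mono[of "\<bar>a\<bar>" "1/2" 2] by (simp add: power2_eq_square)
    \<comment> \<open>Here \<open>n \<ge> 9\<close> enters:
      \<open>1 / 2 + 8 / 81 < 3 / 5\<close>.\<close>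
    have "8 / (real n)\<^sup>2 \<le> 8 / 9\<^sup>2" using n by (intro divide_left_mono power_mono) auto
    then have w: "w \<le> 3 / 5" using a2 by (simp add: w_def)
    have "b\<^sup>2 \<le> 2 * a\<^sup>2 + 2 * (a - b)\<^sup>2"
      using zero_le_power2[of "2 * a - b"] by (simp add: power2_eq_square algebra_simps)
    also have "(a - b)\<^sup>2 = (2 / real n)\<^sup>2" using ab(3) by (metis power2_abs)
    finally have bw: "b\<^sup>2 \<le> w" by (simp add: w_def power_divide)
    have aw: "a\<^sup>2 \<le> w" by (simp add: w_def)
    have "\<bar>poly p (cos (arccos a)) - poly p (cos (arccos b))\<bar> \<le> real d * M * \<bar>arccos a - arccos b\<bar>"
      by (rule poly_cos_lipschitz[OF deg d bound])
    also have "\<dots> \<le> real d * M * ((1 + w) * (2 / real n))"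
      using arccos_lipschitz[OF w aw bw] ab(3) M by (intro mult_left_mono) auto
    finally have "\<bar>(poly p a - poly p b) / 2\<bar> \<le> real d * M / real n * (1 + w)"
      using ab by (simp add: cos_arccos_abs algebra_simps)
    moreover have "0 \<le> a ^ 4" by simp
    ultimately show ?thesis by linarith
  next
    case False
    then have "(1 / 2) ^ 4 \<le> \<bar>a\<bar> ^ 4" by (intro power_mono) auto
    then have "1 \<le> 16 * a ^ 4" by (simp add: power_divide)
    moreover have "0 \<le> real d * M / real n * (1 + w)" using M w0 by simp
    moreover have "\<bar>(poly p a - poly p b) / 2\<bar> \<le> 1" using ab by (auto simp: abs_le_iff)
    ultimately show ?thesis by linarith
  qed
  then show ?thesis by (simp add: w_def)
qed

text \<open>The bound on one step depends on \<open>x\<close> only through the mean, whose second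
  moment is \<open>1 / n\<close> and whose fourth is at most \<open>3 / n^2\<close>. Averaging it
  and summing over the \<open>n\<close> coordinates gives the claim, with 10 = 8 + 2 and 48 = 16 *
  3.\<close>

lemma Influence_poly_of_mean_bound:
  fixes p :: "real poly"
  assumes deg: "degree p \<le> d" and d: "d \<ge> 1" and n: "n \<ge> 9"
    and bound: "\<And>x. \<bar>x\<bar> \<le> 1 \<Longrightarrow> \<bar>poly p x\<bar> \<le> M"
    and f: "\<And>x. x \<in> cube n \<Longrightarrow> f x = poly p ((\<Sum>i<n. x i) / real n)"
    and f1: "\<And>x. x \<in> cube n \<Longrightarrow> \<bar>f x\<bar> \<le> 1"
  shows "Influence n f \<le> real d * M * (1 + 10 / real n) + 48 / real n"
proof -
  have n0: "real n > 0" using n by simp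
  have M: "M \<ge> 0" using bound[of 0] by auto
  define K where "K = real d * M / real n"
  have K: "K \<ge> 0" using M by (simp add: K_def)
  define N where "N = real n"
  \<comment> \<open>The step bound written in the unnormalized sum \<open>s = N * a\<close>.\<close>
  define B where "B s = K * (1 + 8 / N\<^sup>2) + 2 * K / N\<^sup>2 * s\<^sup>2 + 16 / N ^ 4 * s ^ 4" for s
  have step: "\<bar>(f x - f (flip x i)) / 2\<bar> \<le> B (\<Sum>i<n. x i)" if x: "x \<in> cube n" and i: "i < n" for x i
  proof -
    define a where "a = (\<Sum>i<n. x i) / real n"
    define b where "b = (\<Sum>j<n. flip x i j) / real n"
    have fx: "f x = poly p a" "f (flip x i) = poly p b"
      using f[OF x] f[OF flip_in_cube[OF x i]] by (simp_all add: a_def b_def)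
    have "a - b = 2 * x i / real n"
      unfolding a_def b_def sum_flip[OF i] by (simp flip: diff_divide_distrib)
    then have ab: "\<bar>a - b\<bar> = 2 / real n" using cube_abs_coord[OF x i] by (simp add: abs_mult)
    have "\<bar>a\<bar> \<le> 1" "\<bar>b\<bar> \<le> 1"
      using cube_abs_sum_le[OF x] cube_abs_sum_le[OF flip_in_cube[OF x i]] n0
      by (simp_all add: a_def b_def)
    then have "\<bar>(poly p a - poly p b) / 2\<bar> \<le> K * (1 + (2 * a\<^sup>2 + 8 / (real n)\<^sup>2)) + 16 * a ^ 4"
      unfolding K_def using f1[OF x] f1[OF flip_in_cube[OF x i]] fx ab
      by (intro poly_step_bound[OF deg d n bound]) auto
    also have "\<dots> = B (\<Sum>i<n. x i)"
      by (simp add: a_def B_def N_def power_divide algebra_simps)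
    finally show ?thesis by (simp add: fx)
  qed
  have "Influence n f \<le> (\<Sum>i<n. (\<Sum>x\<in>cube n. B (\<Sum>i<n. x i)) / 2 ^ n)"
    unfolding Influence_def cube_expectation_def card_cube
    by (simp only: of_nat_power of_nat_numeral) (intro sum_mono divide_right_mono step; simp)
  also have "\<dots> = real n * ((\<Sum>x\<in>cube n. B (\<Sum>i<n. x i)) / 2 ^ n)" by simp
  finally have "Influence n f \<le> real n * ((\<Sum>x\<in>cube n. B (\<Sum>i<n. x i)) / 2 ^ n)" .
  moreover have "(\<Sum>x\<in>cube n. B (\<Sum>i<n. x i)) / 2 ^ n \<le> K * (1 + 8 / N) + 2 * K / N + 48 / N\<^sup>2"
  proof -
    have "(\<Sum>x\<in>cube n. B (\<Sum>i<n. x i))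
        = 2 ^ n * (K * (1 + 8 / N\<^sup>2)) + 2 * K / N\<^sup>2 * (2 ^ n * N) + 16 / N ^ 4 * (2 ^ n * (3 * N\<^sup>2 - 2 * N))"
      unfolding B_def sum.distrib sum_distrib_left[symmetric] sum_cube_moments N_def
      by (simp add: card_cube distrib_left)
    then have "(\<Sum>x\<in>cube n. B (\<Sum>i<n. x i)) / 2 ^ n = K * (1 + 8 / N\<^sup>2) + 2 * K / N\<^sup>2 * N + 16 / N ^ 4 * (3 * N\<^sup>2 - 2 * N)"
      by (simp add: add_divide_distrib)
    also have "\<dots> \<le> K * (1 + 8 / N) + 2 * K / N + 48 / N\<^sup>2"
    proof -
      have "8 / N\<^sup>2 \<le> 8 / N" using n by (intro divide_left_mono) (auto simp: N_def power2_eq_square)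
      then have "K * (1 + 8 / N\<^sup>2) \<le> K * (1 + 8 / N)" using K by (intro mult_left_mono) auto
      moreover have "2 * K / N\<^sup>2 * N = 2 * K / N" by (simp add: power2_eq_square)
      moreover have "16 / N ^ 4 * (3 * N\<^sup>2 - 2 * N) \<le> 16 / N ^ 4 * (3 * N\<^sup>2)"
        using n by (intro mult_left_mono) (auto simp: N_def)
      moreover have "16 / N ^ 4 * (3 * N\<^sup>2) = 48 / N\<^sup>2"
        using n0 by (simp add: N_def power4_eq_xxxx power2_eq_square)
      ultimately show ?thesis by linarith
    qed
    finally show ?thesis .
  qed
  ultimately have "Influence n f \<le> real n * (K * (1 + 8 / N) + 2 * K / N + 48 / N\<^sup>2)"
    using n0 by (meson mult_left_mono less_imp_le order.trans)
  also have "real n * (K * (1 + 8 / N) + 2 * K / N + 48 / N\<^sup>2) = real d * M * (1 + 10 / real n) + 48 / real n"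
    using n0 by (simp add: K_def N_def field_simps power2_eq_square)
  finally show ?thesis .
qed

text \<open>The trivial bound, which settles small \<open>n\<close>.\<close>

lemma Influence_le_dimension:
  assumes "\<And>x. x \<in> cube n \<Longrightarrow> \<bar>f x\<bar> \<le> 1"
  shows "Influence n f \<le> real n"
proof -
  have "\<bar>(f x - f (flip x i)) / 2\<bar> \<le> 1" if "x \<in> cube n" "i < n" for x i
    using assms[OF that(1)] assms[OF flip_in_cube[OF that]] by (auto simp: abs_le_iff)
  then have "Influence n f \<le> (\<Sum>i<n. (\<Sum>x\<in>cube n. 1) / 2 ^ n)"
    unfolding Influence_def cube_expectation_def card_cube
    by (simp only: of_nat_power of_nat_numeral) (intro sum_mono divide_right_mono; simp)
  then show ?thesis by (simp add: card_cube)
qed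

theorem theorem3p9:
  shows "\<exists>C::real. \<forall>(n::nat) (d::nat) (f :: (nat \<Rightarrow> real) \<Rightarrow> real).
    (\<forall>x\<in>cube n. f x \<in> {-1..1}) \<longrightarrow>
    symmetric_on_cube n f \<longrightarrow>
    cube_degree n f = d \<longrightarrow>
    1 \<le> d \<longrightarrow>
    real d < sqrt (real n) \<longrightarrow>
    Influence n f \<le> real n / (real n - (real d)\<^sup>2)
      * (real d + C * (real d * ln (real d * real n) / real n))"
proof (intro exI allI impI)
  fix n d :: nat and f :: "(nat \<Rightarrow> real) \<Rightarrow> real"
  assume range: "\<forall>x\<in>cube n. f x \<in> {-1..1}" and sym: "symmetric_on_cube n f"
    and deg: "cube_degree n f = d" and d: "1 \<le> d" and dn: "real d < sqrt (real n)"
  have f1: "\<bar>f x\<bar> \<le> 1" if "x \<in> cube n" for x using range that by (auto simp: abs_le_iff)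
  have "(real d)\<^sup>2 < (sqrt (real n))\<^sup>2" using dn by (intro power_strict_mono) auto
  then have d2: "(real d)\<^sup>2 < real n" by simp
  have "1 \<le> (real d)\<^sup>2" using d by simp
  with d2 have n2: "n \<ge> 2" and n0: "real n > 0" by linarith+
  define M where "M = real n / (real n - (real d)\<^sup>2)"
  have M1: "M \<ge> 1" using d2 by (simp add: M_def)
  have "1 * real n \<le> real d * real n" using d by (intro mult_right_mono) auto
  then have "2 \<le> real d * real n" using n2 by linarith
  then have ln: "ln 2 \<le> ln (real d * real n)" by simp
  \<comment> \<open>Since \<open>d * n \<ge> 2\<close>, the logarithm is at least
    \<open>ln 2\<close>, so an error \<open>64 * d / n\<close> fits the claimed form with
    \<open>C = 64 / ln 2\<close>.\<close>
  have log: "64 * real d / real n \<le> 64 / ln 2 * (real d * ln (real d * real n) / real n)"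
  proof -
    have "64 * real d / real n * 1 \<le> 64 * real d / real n * (ln (real d * real n) / ln 2)"
      using ln by (intro mult_left_mono) auto
    then show ?thesis by (simp add: mult_ac)
  qed
  have "Influence n f \<le> M * (real d + 64 * real d / real n)"
  proof (cases "n \<ge> 9")
    case True
    obtain q where q: "degree q \<le> d" "\<And>x. x \<in> cube n \<Longrightarrow> f x = poly q (\<Sum>i<n. x i)"
      using symmetric_as_poly_of_sum[OF sym] deg by auto
    \<comment> \<open>Rescaling passes from the coordinate sum to the mean, which lies in
      [-1,1].\<close>
    define p where "p = pcompose q [:0, real n:]"
    have p: "poly p (s / real n) = poly q s" for s using n0 by (simp add: p_def poly_pcompose)
    have "degree p \<le> degree q * degree [:0, real n:]" unfolding p_def by (rule degree_pcompose_le)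
    then have degp: "degree p \<le> d" using q(1) n0 by simp
    have grid: "\<bar>poly p ((2 * real k - real n) / real n)\<bar> \<le> 1" if k: "k \<le> n" for k
    proof -
      obtain x where "x \<in> cube n" "(\<Sum>i<n. x i) = 2 * real k - real n"
        using cube_point_with_sum[OF k] .
      then show ?thesis using f1[of x] q(2)[of x] by (simp add: p)
    qed
    have "Influence n f \<le> real d * M * (1 + 10 / real n) + 48 / real n"
    proof (rule Influence_poly_of_mean_bound[OF degp d True])
      show "\<bar>poly p x\<bar> \<le> M" if "\<bar>x\<bar> \<le> 1" for x
        unfolding M_def by (rule poly_bound_from_equispaced[OF degp d d2 grid that])
    qed (use q(2) f1 p in auto)
    also have "48 / real n \<le> M * (48 * real d / real n)"
      using mult_mono[of 1 M "48 / real n" "48 * real d / real n"] M1 d n0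
      by (simp add: divide_right_mono)
    also have "real d * M * (1 + 10 / real n) + M * (48 * real d / real n) = M * (real d + 58 * real d / real n)"
      by (simp add: algebra_simps flip: add_divide_distrib)
    also have "\<dots> \<le> M * (real d + 64 * real d / real n)"
      using M1 by (intro mult_left_mono add_left_mono divide_right_mono) auto
    finally show ?thesis by simp
  next
    case False
    have "Influence n f \<le> real n" by (rule Influence_le_dimension[OF f1])
    \<comment> \<open>The constant 64 is \<open>8 ^ 2\<close>, for \<open>n \<le> 8\<close>; the
      case \<open>n \<ge> 9\<close> produces only 10 + 48 = 58.\<close>
    also have "\<dots> \<le> 64 * real d / real n"
    proof -
      have "real n * real n \<le> 8 * 8" using False by (intro mult_mono) auto
      also have "\<dots> \<le> 64 * real d" using d by simp
      finally show ?thesis using n0 by (simp add: field_simps)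
    qed
    also have "\<dots> \<le> 1 * (real d + 64 * real d / real n)" by simp
    also have "\<dots> \<le> M * (real d + 64 * real d / real n)" using M1 by (intro mult_right_mono) auto
    finally show ?thesis .
  qed
  also have "\<dots> \<le> M * (real d + 64 / ln 2 * (real d * ln (real d * real n) / real n))"
    using log M1 by (intro mult_left_mono) auto
  finally show "Influence n f \<le> real n / (real n - (real d)\<^sup>2)
      * (real d + 64 / ln 2 * (real d * ln (real d * real n) / real n))"
    unfolding M_def .
qed

end
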